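(* The virtual braid $\beta=(\tau_3\sigma_2\tau_1\sigma_2^{-1})^3\in\mathcal{VB}_4$ is in the kernel of the homomorphism $\psi:\mathcal{VB}_4\to\mathrm{Aut}(F_5)$, where $F_5$ is the free group on $x_1,x_2,x_3,x_4,q$ and $\psi$ is defined, for $1\le i\le 3$, by $\psi(\sigma_i)(q)=\psi(\tau_i)(q)=q$ and \[\psi(\sigma_i)(x_j)=\begin{cases}x_j & j\ne i,i+1\\ x_ix_{i+1}x_i^{-1}& j=i\\ x_i & j=i+1\end{cases},\qquad \psi(\tau_i)(x_j)=\begin{cases}x_j & j\ne i,i+1\\ qx_{i+1}q^{-1}& j=i\\ q^{-1}x_iq & j=i+1\end{cases}.\]
   Context: The virtual braid group $\mathcal{VB}_n$ has generators $\sigma_1,\dots,\sigma_{n-1},\tau_1,\dots,\tau_{n-1}$ and relations: $\sigma_i\sigma_j=\sigma_j\sigma_i$, $\tau_i\tau_j=\tau_j\tau_i$, $\sigma_i\tau_j=\tau_j\sigma_i$ for $|i-j|>1$; $\sigma_i\sigma_{i+1}\sigma_i=\sigma_{i+1}\sigma_i\sigma_{i+1}$, $\tau_i\tau_{i+1}\tau_i=\tau_{i+1}\tau_i\tau_{i+1}$, $\tau_{i+1}\sigma_i\tau_{i+1}=\tau_i\sigma_{i+1}\tau_i$ for $1\le i\le n-2$; $\tau_i^2=1$ for $1\le i\le n-1$. The product in $\mathrm{Aut}(F_5)$ is composition of functions, $\psi(\alpha\beta)=\psi(\alpha)\circ\psi(\beta)$. *)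

theory Defs
  imports "HOL-Algebra.Bij" "HOL-Algebra.Coset"
begin

section \<open>Groups given by generators and relations\<close>

text \<open>The letter \<open>(x, True)\<close> stands for the generator \<open>x\<close> and \<open>(x, False)\<close> for its formal
  inverse. A relation \<open>r = s\<close> is a pair \<open>(r, s)\<close> of words.\<close>

type_synonym 'a word = "('a \<times> bool) list"

abbreviation words :: "'a set \<Rightarrow> 'a word set"
  where "words X \<equiv> lists (X \<times> UNIV)"

inductive_set pres_rel :: "'a set \<Rightarrow> ('a word \<times> 'a word) set \<Rightarrow> ('a word \<times> 'a word) set"
  for X :: "'a set" and R :: "('a word \<times> 'a word) set"
where
  refl: "u \<in> words X \<Longrightarrow> (u, u) \<in> pres_rel X R"
| sym: "(u, v) \<in> pres_rel X R \<Longrightarrow> (v, u) \<in> pres_rel X R"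
| trans: "(u, v) \<in> pres_rel X R \<Longrightarrow> (v, w) \<in> pres_rel X R \<Longrightarrow> (u, w) \<in> pres_rel X R"
| cancel: "u \<in> words X \<Longrightarrow> v \<in> words X \<Longrightarrow> x \<in> X
    \<Longrightarrow> (u @ [(x, b), (x, \<not> b)] @ v, u @ v) \<in> pres_rel X R"
| relation: "u \<in> words X \<Longrightarrow> v \<in> words X \<Longrightarrow> (r, s) \<in> R \<Longrightarrow> r \<in> words X \<Longrightarrow> s \<in> words X
    \<Longrightarrow> (u @ r @ v, u @ s @ v) \<in> pres_rel X R"

definition pres_group :: "'a set \<Rightarrow> ('a word \<times> 'a word) set \<Rightarrow> 'a word set monoid"
  where "pres_group X R =
    \<lparr>carrier = words X // pres_rel X R,
     mult = \<lambda>A B. \<Union>u\<in>A. \<Union>v\<in>B. pres_rel X R `` {u @ v},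
     one = pres_rel X R `` {[]}\<rparr>"

definition pres_gen :: "'a set \<Rightarrow> ('a word \<times> 'a word) set \<Rightarrow> 'a \<Rightarrow> 'a word set"
  where "pres_gen X R x = pres_rel X R `` {[(x, True)]}"

lemma pres_rel_words:
  assumes "(u, v) \<in> pres_rel X R"
  shows "u \<in> words X" "v \<in> words X"
  using assms by (induction rule: pres_rel.induct) auto

lemma equiv_pres_rel: "equiv (words X) (pres_rel X R)"
  using pres_rel_words
  by (auto intro!: equivI refl_onI symI transI pres_rel.refl
      intro: pres_rel.sym pres_rel.trans) blast+

lemma pres_rel_context:
  assumes "(u, v) \<in> pres_rel X R" "p \<in> words X" "q \<in> words X"
  shows "(p @ u @ q, p @ v @ q) \<in> pres_rel X R"
  using assms
proof (induction rule: pres_rel.induct)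
  case (refl u)
  then show ?case by (intro pres_rel.refl) auto
next
  case (sym u v)
  then show ?case by (blast intro: pres_rel.sym)
next
  case (trans u v w)
  then show ?case by (blast intro: pres_rel.trans)
next
  case (cancel u v x b)
  then show ?case
    using pres_rel.cancel[of "p @ u" X "v @ q" x b R] by simp
next
  case (relation u v r s)
  then show ?case
    using pres_rel.relation[of "p @ u" X "v @ q" r s R] by simp
qed

lemma pres_rel_append:
  assumes "(u, u') \<in> pres_rel X R" "(v, v') \<in> pres_rel X R"
  shows "(u @ v, u' @ v') \<in> pres_rel X R"
proof -
  have "(u @ v, u' @ v) \<in> pres_rel X R"
    using pres_rel_context[OF assms(1), of "[]" v] pres_rel_words[OF assms(2)] by simp
  moreover have "(u' @ v, u' @ v') \<in> pres_rel X R"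
    using pres_rel_context[OF assms(2), of u' "[]"] pres_rel_words[OF assms(1)] by simp
  ultimately show ?thesis by (rule pres_rel.trans)
qed

lemma pres_group_mult_class:
  assumes "u \<in> words X" "v \<in> words X"
  shows "pres_rel X R `` {u} \<otimes>\<^bsub>pres_group X R\<^esub> pres_rel X R `` {v} = pres_rel X R `` {u @ v}"
proof -
  have "pres_rel X R `` {u' @ v'} = pres_rel X R `` {u @ v}"
    if "u' \<in> pres_rel X R `` {u}" "v' \<in> pres_rel X R `` {v}" for u' v'
    using that equiv_class_eq[OF equiv_pres_rel] pres_rel_append by fastforce
  then have "(\<Union>u'\<in>pres_rel X R `` {u}. \<Union>v'\<in>pres_rel X R `` {v}. pres_rel X R `` {u' @ v'})
      = (\<Union>u'\<in>pres_rel X R `` {u}. \<Union>v'\<in>pres_rel X R `` {v}. pres_rel X R `` {u @ v})"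
    by (intro SUP_cong HOL.refl)
  moreover have "u \<in> pres_rel X R `` {u}" "v \<in> pres_rel X R `` {v}"
    using assms by (auto intro: pres_rel.refl)
  ultimately show ?thesis
    unfolding pres_group_def monoid.simps by blast
qed

lemma pres_rel_inverse:
  assumes "u \<in> words X"
  shows "(rev (map (\<lambda>(x, b). (x, \<not> b)) u) @ u, []) \<in> pres_rel X R"
  using assms
proof (induction u rule: list.induct)
  case Nil
  then show ?case by (auto intro: pres_rel.refl)
next
  case (Cons a u)
  obtain x b where a: "a = (x, b)" by (cases a)
  let ?i = "rev (map (\<lambda>(x, b). (x, \<not> b)) u)"
  have x: "x \<in> X" and u: "u \<in> words X" using Cons.prems a by auto
  have "?i \<in> words X" using u by (auto simp: lists_eq_set)
  then have "(?i @ [(x, \<not> b), (x, \<not> \<not> b)] @ u, ?i @ u) \<in> pres_rel X R"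
    using x u by (intro pres_rel.cancel)
  then show ?case
    using Cons.IH[OF u] a by (auto intro: pres_rel.trans)
qed

theorem group_pres_group: "group (pres_group X R)"
proof (rule groupI)
  let ?G = "pres_group X R"
  let ?c = "\<lambda>u. pres_rel X R `` {u}"
  have carr: "carrier ?G = words X // pres_rel X R" and one: "\<one>\<^bsub>?G\<^esub> = ?c []"
    by (simp_all add: pres_group_def)
  have cls: "?c u \<in> carrier ?G" if "u \<in> words X" for u
    using that by (simp add: carr quotientI)
  show "\<one>\<^bsub>?G\<^esub> \<in> carrier ?G" by (simp add: one cls)
  fix a assume "a \<in> carrier ?G"
  then obtain u where u: "u \<in> words X" "a = ?c u" unfolding carr by (rule quotientE)
  show "\<one>\<^bsub>?G\<^esub> \<otimes>\<^bsub>?G\<^esub> a = a" using u by (simp add: one pres_group_mult_class)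
  show "\<exists>b\<in>carrier ?G. b \<otimes>\<^bsub>?G\<^esub> a = \<one>\<^bsub>?G\<^esub>"
  proof
    let ?i = "rev (map (\<lambda>(x, b). (x, \<not> b)) u)"
    have i: "?i \<in> words X" using u by (auto simp: lists_eq_set)
    then show "?c ?i \<in> carrier ?G" by (rule cls)
    show "?c ?i \<otimes>\<^bsub>?G\<^esub> a = \<one>\<^bsub>?G\<^esub>"
      using u i equiv_class_eq[OF equiv_pres_rel pres_rel_inverse[OF u(1)]]
      by (simp add: one pres_group_mult_class)
  qed
  fix b assume "b \<in> carrier ?G"
  then obtain v where v: "v \<in> words X" "b = ?c v" unfolding carr by (rule quotientE)
  show "a \<otimes>\<^bsub>?G\<^esub> b \<in> carrier ?G" using u v by (simp add: pres_group_mult_class cls)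
  fix c assume "c \<in> carrier ?G"
  then obtain w where w: "w \<in> words X" "c = ?c w" unfolding carr by (rule quotientE)
  show "a \<otimes>\<^bsub>?G\<^esub> b \<otimes>\<^bsub>?G\<^esub> c = a \<otimes>\<^bsub>?G\<^esub> (b \<otimes>\<^bsub>?G\<^esub> c)"
    using u v w by (simp add: pres_group_mult_class)
qed

abbreviation free_group :: "'a set \<Rightarrow> 'a word set monoid"
  where "free_group X \<equiv> pres_group X {}"

abbreviation free_gen :: "'a set \<Rightarrow> 'a \<Rightarrow> 'a word set"
  where "free_gen X x \<equiv> pres_gen X {} x"


section \<open>The virtual braid group\<close>

datatype vb_generator = Sigma_gen nat | Tau_gen nat

abbreviation s_letter :: "nat \<Rightarrow> vb_generator \<times> bool"
  where "s_letter i \<equiv> (Sigma_gen i, True)"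

abbreviation t_letter :: "nat \<Rightarrow> vb_generator \<times> bool"
  where "t_letter i \<equiv> (Tau_gen i, True)"

definition vb_generators :: "nat \<Rightarrow> vb_generator set"
  where "vb_generators n = Sigma_gen ` {i. 1 \<le> i \<and> i < n} \<union> Tau_gen ` {i. 1 \<le> i \<and> i < n}"

inductive_set vb_relations :: "nat \<Rightarrow> (vb_generator word \<times> vb_generator word) set"
  for n :: nat
where
  sigma_far: "\<lbrakk>1 \<le> i; i < n; 1 \<le> j; j < n; \<bar>int i - int j\<bar> > 1\<rbrakk>
    \<Longrightarrow> ([s_letter i, s_letter j], [s_letter j, s_letter i]) \<in> vb_relations n"
| tau_far: "\<lbrakk>1 \<le> i; i < n; 1 \<le> j; j < n; \<bar>int i - int j\<bar> > 1\<rbrakk>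
    \<Longrightarrow> ([t_letter i, t_letter j], [t_letter j, t_letter i]) \<in> vb_relations n"
| sigma_tau_far: "\<lbrakk>1 \<le> i; i < n; 1 \<le> j; j < n; \<bar>int i - int j\<bar> > 1\<rbrakk>
    \<Longrightarrow> ([s_letter i, t_letter j], [t_letter j, s_letter i]) \<in> vb_relations n"
| sigma_braid: "\<lbrakk>1 \<le> i; i + 1 < n\<rbrakk>
    \<Longrightarrow> ([s_letter i, s_letter (i+1), s_letter i],
         [s_letter (i+1), s_letter i, s_letter (i+1)]) \<in> vb_relations n"
| tau_braid: "\<lbrakk>1 \<le> i; i + 1 < n\<rbrakk>
    \<Longrightarrow> ([t_letter i, t_letter (i+1), t_letter i],
         [t_letter (i+1), t_letter i, t_letter (i+1)]) \<in> vb_relations n"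
| mixed: "\<lbrakk>1 \<le> i; i + 1 < n\<rbrakk>
    \<Longrightarrow> ([t_letter (i+1), s_letter i, t_letter (i+1)],
         [t_letter i, s_letter (i+1), t_letter i]) \<in> vb_relations n"
| tau_square: "\<lbrakk>1 \<le> i; i < n\<rbrakk> \<Longrightarrow> ([t_letter i, t_letter i], []) \<in> vb_relations n"

definition virtual_braid_group :: "nat \<Rightarrow> vb_generator word set monoid"
  where "virtual_braid_group n = pres_group (vb_generators n) (vb_relations n)"

definition vb_sigma :: "nat \<Rightarrow> nat \<Rightarrow> vb_generator word set"
  where "vb_sigma n i = pres_gen (vb_generators n) (vb_relations n) (Sigma_gen i)"

definition vb_tau :: "nat \<Rightarrow> nat \<Rightarrow> vb_generator word set"
  where "vb_tau n i = pres_gen (vb_generators n) (vb_relations n) (Tau_gen i)"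


section \<open>The free group \<open>F\<^sub>5\<close> and the homomorphism \<open>\<psi>\<close>\<close>

datatype f5_generator = X_gen nat | Q_gen

definition f5_generators :: "f5_generator set"
  where "f5_generators = {X_gen 1, X_gen 2, X_gen 3, X_gen 4, Q_gen}"

definition F5 :: "f5_generator word set monoid"
  where "F5 = free_group f5_generators"

definition f5_x :: "nat \<Rightarrow> f5_generator word set"
  where "f5_x j = free_gen f5_generators (X_gen j)"

definition f5_q :: "f5_generator word set"
  where "f5_q = free_gen f5_generators Q_gen"

text \<open>Multiplication in \<^const>\<open>AutoGroup\<close> is composition of functions:
  \<open>f \<otimes> g\<close> first applies \<open>g\<close> and then \<open>f\<close>.\<close>

definition is_psi ::
  "(vb_generator word set \<Rightarrow> f5_generator word set \<Rightarrow> f5_generator word set) \<Rightarrow> bool"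
  where "is_psi \<psi> \<longleftrightarrow>
    \<psi> \<in> hom (virtual_braid_group 4) (AutoGroup F5) \<and>
    (\<forall>i\<in>{1..3}.
      \<psi> (vb_sigma 4 i) f5_q = f5_q \<and>
      \<psi> (vb_tau 4 i) f5_q = f5_q \<and>
      (\<forall>j\<in>{1..4}.
        \<psi> (vb_sigma 4 i) (f5_x j) =
          (if j = i then f5_x i \<otimes>\<^bsub>F5\<^esub> f5_x (i+1) \<otimes>\<^bsub>F5\<^esub> inv\<^bsub>F5\<^esub> f5_x i
           else if j = i + 1 then f5_x i
           else f5_x j) \<and>
        \<psi> (vb_tau 4 i) (f5_x j) =
          (if j = i then f5_q \<otimes>\<^bsub>F5\<^esub> f5_x (i+1) \<otimes>\<^bsub>F5\<^esub> inv\<^bsub>F5\<^esub> f5_q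
           else if j = i + 1 then inv\<^bsub>F5\<^esub> f5_q \<otimes>\<^bsub>F5\<^esub> f5_x i \<otimes>\<^bsub>F5\<^esub> f5_q
           else f5_x j)))"

definition vb_beta :: "vb_generator word set"
  where "vb_beta =
    (vb_tau 4 3 \<otimes>\<^bsub>virtual_braid_group 4\<^esub> vb_sigma 4 2 \<otimes>\<^bsub>virtual_braid_group 4\<^esub> vb_tau 4 1
      \<otimes>\<^bsub>virtual_braid_group 4\<^esub> inv\<^bsub>virtual_braid_group 4\<^esub> vb_sigma 4 2)
    [^]\<^bsub>virtual_braid_group 4\<^esub> (3::nat)"

end

theory Submission
  imports Defs
begin

text \<open>An endomorphism of a free group is determined by words representing the images of the
  generators, and composing endomorphisms amounts to substituting words. Two such endomorphisms
  are equal as soon as these words have the same free reduction, so the defining relations of the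
  virtual braid group and the triviality of \<open>\<psi>(\<beta>)\<close> become finite computations with words. Any
  \<open>\<psi>\<close> as in the theorem agrees on the generators with the homomorphism obtained from the
  universal property of the presentation, so one computation covers every such \<open>\<psi>\<close>.\<close>

section \<open>Evaluating words in a group\<close>

definition letter_value :: "('g, 'm) monoid_scheme \<Rightarrow> ('a \<Rightarrow> 'g) \<Rightarrow> 'a \<times> bool \<Rightarrow> 'g"
  where "letter_value G f l = (if snd l then f (fst l) else inv\<^bsub>G\<^esub> f (fst l))"

primrec word_value :: "('g, 'm) monoid_scheme \<Rightarrow> ('a \<Rightarrow> 'g) \<Rightarrow> 'a word \<Rightarrow> 'g"
  where
    "word_value G f [] = \<one>\<^bsub>G\<^esub>"
  | "word_value G f (l # w) = letter_value G f l \<otimes>\<^bsub>G\<^esub> word_value G f w"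

context group
begin

lemma letter_value_closed:
  "f \<in> X \<rightarrow> carrier G \<Longrightarrow> l \<in> X \<times> UNIV \<Longrightarrow> letter_value G f l \<in> carrier G"
  by (auto simp: letter_value_def)

lemma word_value_closed:
  assumes "f \<in> X \<rightarrow> carrier G" "w \<in> words X"
  shows "word_value G f w \<in> carrier G"
  using assms(2)
proof (induction w)
  case (Cons l w)
  then have "letter_value G f l \<in> carrier G" "w \<in> words X"
    using letter_value_closed[OF assms(1)] by blast+
  with Cons show ?case by simp
qed simp

lemma word_value_append:
  assumes f: "f \<in> X \<rightarrow> carrier G" and "u \<in> words X" and v: "v \<in> words X"
  shows "word_value G f (u @ v) = word_value G f u \<otimes> word_value G f v"
  using assms(2)
proof (induction u)
  case (Cons l u)
  then have "letter_value G f l \<in> carrier G" "u \<in> words X"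
    using letter_value_closed[OF f] by blast+
  with Cons show ?case
    using word_value_closed[OF f] v by (simp add: m_assoc)
qed (use word_value_closed[OF f v] in simp)

lemma word_value_cong:
  assumes "\<And>x. x \<in> X \<Longrightarrow> f x = g x" "w \<in> words X"
  shows "word_value G f w = word_value G g w"
  using assms(2) by (induction w) (auto simp: letter_value_def assms(1))

text \<open>Every generating step of \<open>pres_rel\<close> preserves values: a cancelled pair
  evaluates to an element times its inverse, the two sides of a relation agree by the hypothesis on
  \<open>R\<close>, and values multiply along concatenation.\<close>

lemma word_value_pres_rel:
  assumes f: "f \<in> X \<rightarrow> carrier G"
    and R: "\<And>r s. (r, s) \<in> R \<Longrightarrow> word_value G f r = word_value G f s"
    and "(u, v) \<in> pres_rel X R"
  shows "word_value G f u = word_value G f v"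
  using assms(3)
proof (induction rule: pres_rel.induct)
  case (cancel u v x b)
  have fx: "f x \<in> carrier G" using f cancel by blast
  have "word_value G f [(x, b), (x, \<not> b)] = \<one>"
    using fx by (simp add: letter_value_def)
  moreover have "[(x, b), (x, \<not> b)] \<in> words X" using cancel by simp
  ultimately show ?case
    using cancel word_value_closed[OF f]
    by (simp only: word_value_append[OF f] append_in_lists_conv) simp
next
  case (relation u v r s)
  then show ?case
    by (simp add: word_value_append[OF f] R[OF relation(3)])
qed simp_all

end

section \<open>The universal property of a presentation\<close>

text \<open>The homomorphism induced by \<open>f\<close>, read off an arbitrary representative of
  the class. The choice is harmless as soon as \<open>f\<close> respects the relations.\<close>

definition pres_lift :: "('g, 'm) monoid_scheme \<Rightarrow> ('a \<Rightarrow> 'g) \<Rightarrow> 'a word set \<Rightarrow> 'g"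
  where "pres_lift G f A = word_value G f (SOME w. w \<in> A)"

lemma carrier_pres_group: "carrier (pres_group X R) = words X // pres_rel X R"
  and one_pres_group: "\<one>\<^bsub>pres_group X R\<^esub> = pres_rel X R `` {[]}"
  by (simp_all add: pres_group_def)

lemma pres_class_closed: "w \<in> words X \<Longrightarrow> pres_rel X R `` {w} \<in> carrier (pres_group X R)"
  by (simp add: carrier_pres_group quotientI)

lemma pres_group_cases:
  assumes "a \<in> carrier (pres_group X R)"
  obtains w where "w \<in> words X" "a = pres_rel X R `` {w}"
  using assms unfolding carrier_pres_group by (rule quotientE)

text \<open>The reversed word with flipped signs is a left inverse by
  \<open>pres_rel_inverse\<close>, and in a group a left inverse is the inverse.\<close>

lemma inv_pres_class:
  assumes "w \<in> words X"
  shows "inv\<^bsub>pres_group X R\<^esub> (pres_rel X R `` {w})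
    = pres_rel X R `` {rev (map (\<lambda>(x, b). (x, \<not> b)) w)}"
proof -
  have i: "rev (map (\<lambda>(x, b). (x, \<not> b)) w) \<in> words X"
    using assms by (auto simp: lists_eq_set)
  show ?thesis
    using assms i equiv_class_eq[OF equiv_pres_rel pres_rel_inverse[OF assms]]
    by (intro group.inv_equality[OF group_pres_group])
      (simp_all add: one_pres_group pres_group_mult_class pres_class_closed)
qed

context group
begin

lemma pres_lift_class:
  assumes f: "f \<in> X \<rightarrow> carrier G"
    and R: "\<And>r s. (r, s) \<in> R \<Longrightarrow> word_value G f r = word_value G f s"
    and w: "w \<in> words X"
  shows "pres_lift G f (pres_rel X R `` {w}) = word_value G f w"
proof -
  have "w \<in> pres_rel X R `` {w}" using w by (auto intro: pres_rel.refl)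
  then have "(SOME u. u \<in> pres_rel X R `` {w}) \<in> pres_rel X R `` {w}" by (rule someI)
  then show ?thesis
    unfolding pres_lift_def using word_value_pres_rel[OF f R] by (metis Image_singleton_iff)
qed

lemma pres_lift_hom:
  assumes f: "f \<in> X \<rightarrow> carrier G"
    and R: "\<And>r s. (r, s) \<in> R \<Longrightarrow> word_value G f r = word_value G f s"
  shows "pres_lift G f \<in> hom (pres_group X R) G"
proof (rule homI)
  fix a assume "a \<in> carrier (pres_group X R)"
  then obtain u where u: "u \<in> words X" "a = pres_rel X R `` {u}" by (rule pres_group_cases)
  then show "pres_lift G f a \<in> carrier G"
    by (simp add: pres_lift_class[OF f R] word_value_closed[OF f])
  fix b assume "b \<in> carrier (pres_group X R)"
  then obtain v where v: "v \<in> words X" "b = pres_rel X R `` {v}" by (rule pres_group_cases)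
  show "pres_lift G f (a \<otimes>\<^bsub>pres_group X R\<^esub> b) = pres_lift G f a \<otimes> pres_lift G f b"
    using u v by (simp add: pres_lift_class[OF f R] word_value_append[OF f] pres_group_mult_class)
qed

lemma pres_lift_gen:
  assumes f: "f \<in> X \<rightarrow> carrier G"
    and R: "\<And>r s. (r, s) \<in> R \<Longrightarrow> word_value G f r = word_value G f s"
    and x: "x \<in> X"
  shows "pres_lift G f (pres_gen X R x) = f x"
proof -
  \<comment> \<open>A one-letter word evaluates to \<open>f x\<close> times the unit; closedness
    removes the unit.\<close>
  have "f x \<in> carrier G" using f x by blast
  then show ?thesis
    using x by (simp add: pres_gen_def pres_lift_class[OF f R] letter_value_def)
qed

text \<open>The uniqueness half of the universal property: peeling off one letter at a time shows
  that the images of the generators determine \<open>h\<close>. Negative letters are covered because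
  homomorphisms preserve inverses.\<close>

lemma hom_pres_class:
  assumes h: "h \<in> hom (pres_group X R) G" and "w \<in> words X"
  shows "h (pres_rel X R `` {w}) = word_value G (\<lambda>x. h (pres_gen X R x)) w"
proof -
  interpret h: group_hom "pres_group X R" G h
    using h group_pres_group is_group by (simp add: group_hom_def group_hom_axioms_def)
  show ?thesis
    using assms(2)
  proof (induction w)
    case Nil
    then show ?case using h.hom_one by (simp add: one_pres_group)
  next
    case (Cons l w)
    obtain x b where l: "l = (x, b)" by (cases l)
    have x: "x \<in> X" and w: "w \<in> words X" using Cons l by auto
    have "pres_rel X R `` {[(x, False)]} = inv\<^bsub>pres_group X R\<^esub> pres_gen X R x"
      using x by (simp add: pres_gen_def inv_pres_class)
    moreover have "pres_gen X R x \<in> carrier (pres_group X R)"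
      using x by (simp add: pres_gen_def pres_class_closed)
    ultimately have "h (pres_rel X R `` {[l]}) = letter_value G (\<lambda>x. h (pres_gen X R x)) l"
      by (cases b) (simp_all add: l letter_value_def, simp add: pres_gen_def)
    moreover have "pres_rel X R `` {l # w}
        = pres_rel X R `` {[l]} \<otimes>\<^bsub>pres_group X R\<^esub> pres_rel X R `` {w}"
      using x w l by (simp add: pres_group_mult_class)
    ultimately show ?case
      using Cons.IH x w l by (simp add: pres_class_closed)
  qed
qed

end

section \<open>Substitution endomorphisms of a free group\<close>

text \<open>An endomorphism at the level of words, with no cancellation performed.\<close>

definition word_subst :: "('a \<Rightarrow> 'b word) \<Rightarrow> 'a word \<Rightarrow> 'b word"
  where "word_subst \<phi> w =
    concat (map (\<lambda>(x, b). if b then \<phi> x else rev (map (\<lambda>(y, c). (y, \<not> c)) (\<phi> x))) w)"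

text \<open>One step of free reduction: in front of a reduced word, a new letter can only cancel
  against the head. Folding from the right, as \<open>free_reduce\<close> does, keeps the tail
  reduced throughout.\<close>

fun cancel_cons :: "'a \<times> bool \<Rightarrow> 'a word \<Rightarrow> 'a word"
  where
    "cancel_cons l [] = [l]"
  | "cancel_cons l (m # w) = (if fst l = fst m \<and> snd l \<noteq> snd m then w else l # m # w)"

definition free_reduce :: "'a word \<Rightarrow> 'a word"
  where "free_reduce w = foldr cancel_cons w []"

text \<open>The restriction to the carrier makes the map extensional, as elements of
  \<open>AutoGroup\<close> have to be.\<close>

definition subst_hom :: "'a set \<Rightarrow> ('a \<Rightarrow> 'a word) \<Rightarrow> 'a word set \<Rightarrow> 'a word set"
  where "subst_hom X \<phi> =
    (\<lambda>A\<in>carrier (free_group X). pres_lift (free_group X) (\<lambda>x. pres_rel X {} `` {\<phi> x}) A)"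

lemma word_subst_words:
  assumes \<phi>: "\<phi> \<in> X \<rightarrow> words X" and "w \<in> words X"
  shows "word_subst \<phi> w \<in> words X"
  using assms(2)
proof (induction w)
  case (Cons l w)
  then have "\<phi> (fst l) \<in> words X" using \<phi> by auto
  then have "word_subst \<phi> [l] \<in> words X"
    by (auto simp: word_subst_def lists_eq_set split: prod.split)
  moreover have "word_subst \<phi> (l # w) = word_subst \<phi> [l] @ word_subst \<phi> w"
    by (simp add: word_subst_def)
  ultimately show ?case using Cons.IH by simp
qed (simp add: word_subst_def)

lemma pres_rel_cancel_cons:
  assumes "l # w \<in> words X"
  shows "(l # w, cancel_cons l w) \<in> pres_rel X R"
proof (cases w)
  case Nil
  then show ?thesis using assms by (auto intro: pres_rel.refl)
next
  case (Cons m v)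
  show ?thesis
  proof (cases "fst l = fst m \<and> snd l \<noteq> snd m")
    case True
    \<comment> \<open>Signs are booleans, so differing signs make \<open>m\<close> the formal
      inverse of \<open>l\<close>.\<close>
    then have "m = (fst l, \<not> snd l)" by (auto simp: prod_eq_iff)
    then show ?thesis
      using assms Cons pres_rel.cancel[of "[]" X v "fst l" "snd l" R] by auto
  next
    case False
    then have "cancel_cons l w = l # w" using Cons by simp
    then show ?thesis using pres_rel.refl[OF assms] by simp
  qed
qed

lemma pres_rel_free_reduce:
  assumes "w \<in> words X"
  shows "(w, free_reduce w) \<in> pres_rel X R"
  using assms
proof (induction w)
  case Nil
  then show ?case by (auto simp: free_reduce_def intro: pres_rel.refl)
next
  case (Cons l w)
  then have "([l] @ w, [l] @ free_reduce w) \<in> pres_rel X R"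
    by (intro pres_rel_append) (auto intro: pres_rel.refl)
  then show ?case
    using pres_rel_cancel_cons[of l "free_reduce w" X R] pres_rel_words(2)
    by (fastforce simp: free_reduce_def intro: pres_rel.trans)
qed

lemma pres_class_free_reduce:
  "w \<in> words X \<Longrightarrow> pres_rel X R `` {free_reduce w} = pres_rel X R `` {w}"
  using equiv_class_eq[OF equiv_pres_rel pres_rel_free_reduce] by blast

lemma free_reduce_words: "w \<in> words X \<Longrightarrow> free_reduce w \<in> words X"
  using pres_rel_words(2)[OF pres_rel_free_reduce] by blast

section \<open>Homomorphisms given by substitutions\<close>

context
  fixes X :: "'a set" and \<phi> :: "'a \<Rightarrow> 'a word"
  assumes \<phi>: "\<phi> \<in> X \<rightarrow> words X"
begin

interpretation F: group "free_group X"
  by (rule group_pres_group)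

private lemma images_closed: "(\<lambda>x. pres_rel X {} `` {\<phi> x}) \<in> X \<rightarrow> carrier (free_group X)"
  using \<phi> by (auto intro!: pres_class_closed)

text \<open>This replaces the choice of representatives by a computation on words: in the free group
  each letter contributes the class of \<open>\<phi> x\<close> or of its formal inverse, and
  multiplying classes concatenates words.\<close>

lemma subst_hom_class:
  assumes "w \<in> words X"
  shows "subst_hom X \<phi> (pres_rel X {} `` {w}) = pres_rel X {} `` {word_subst \<phi> w}"
proof -
  have "word_value (free_group X) (\<lambda>x. pres_rel X {} `` {\<phi> x}) w
      = pres_rel X {} `` {word_subst \<phi> w}"
    using assms
  proof (induction w)
    case Nil
    then show ?case by (simp add: word_subst_def one_pres_group)
  next
    case (Cons l w)
    obtain x b where l: "l = (x, b)" by (cases l)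
    have x: "\<phi> x \<in> words X" and lw: "[l] \<in> words X" and w: "w \<in> words X"
      using Cons l \<phi> by auto
    have "letter_value (free_group X) (\<lambda>x. pres_rel X {} `` {\<phi> x}) l
        = pres_rel X {} `` {word_subst \<phi> [l]}"
      using x by (simp add: l letter_value_def word_subst_def inv_pres_class)
    moreover have "word_subst \<phi> (l # w) = word_subst \<phi> [l] @ word_subst \<phi> w"
      by (simp add: word_subst_def)
    ultimately show ?case
      using Cons.IH word_subst_words[OF \<phi> lw] word_subst_words[OF \<phi> w]
      by (simp add: pres_group_mult_class)
  qed
  \<comment> \<open>A free group has no relations, so the condition for lifting is vacuous.\<close>
  then show ?thesis
    using F.pres_lift_class[OF images_closed, of "{}"] assms
    by (simp add: subst_hom_def pres_class_closed)
qed

lemma subst_hom_hom: "subst_hom X \<phi> \<in> hom (free_group X) (free_group X)"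
  using F.pres_lift_hom[OF images_closed, of "{}"] F.m_closed
  by (simp add: subst_hom_def hom_def Pi_iff)

lemma subst_hom_gen: "x \<in> X \<Longrightarrow> subst_hom X \<phi> (free_gen X x) = pres_rel X {} `` {\<phi> x}"
  by (simp add: pres_gen_def subst_hom_class word_subst_def)

text \<open>On the carrier both maps are determined by the generators; outside it both are
  \<open>undefined\<close> by extensionality.\<close>

lemma hom_eq_subst_hom:
  assumes h: "h \<in> hom (free_group X) (free_group X)" "h \<in> extensional (carrier (free_group X))"
    and gen: "\<And>x. x \<in> X \<Longrightarrow> h (free_gen X x) = pres_rel X {} `` {\<phi> x}"
  shows "h = subst_hom X \<phi>"
proof (rule extensionalityI[OF h(2)])
  show "subst_hom X \<phi> \<in> extensional (carrier (free_group X))" by (simp add: subst_hom_def)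
  fix a assume "a \<in> carrier (free_group X)"
  then obtain w where w: "w \<in> words X" "a = pres_rel X {} `` {w}" by (rule pres_group_cases)
  show "h a = subst_hom X \<phi> a"
    unfolding w(2) F.hom_pres_class[OF h(1) w(1)] F.hom_pres_class[OF subst_hom_hom w(1)]
    by (rule F.word_value_cong[OF _ w(1)]) (simp add: gen subst_hom_gen)
qed

end

text \<open>Both sides are homomorphisms, so comparing them on generators suffices. Reducing the
  substituted words leaves their classes unchanged and lets later equalities be tested letter by
  letter.\<close>

lemma compose_subst_hom:
  assumes \<phi>: "\<phi> \<in> X \<rightarrow> words X" and \<chi>: "\<chi> \<in> X \<rightarrow> words X"
  shows "compose (carrier (free_group X)) (subst_hom X \<phi>) (subst_hom X \<chi>)
    = subst_hom X (\<lambda>x. free_reduce (word_subst \<phi> (\<chi> x)))"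
proof (rule hom_eq_subst_hom)
  interpret F: group "free_group X" by (rule group_pres_group)
  have \<chi>w: "\<chi> x \<in> words X" if "x \<in> X" for x using \<chi> that by blast
  show "(\<lambda>x. free_reduce (word_subst \<phi> (\<chi> x))) \<in> X \<rightarrow> words X"
    by (intro funcsetI free_reduce_words word_subst_words[OF \<phi>] \<chi>w)
  show "compose (carrier (free_group X)) (subst_hom X \<phi>) (subst_hom X \<chi>)
      \<in> hom (free_group X) (free_group X)"
    using subst_hom_hom[OF \<chi>] subst_hom_hom[OF \<phi>] by (rule F.hom_compose)
  show "compose (carrier (free_group X)) (subst_hom X \<phi>) (subst_hom X \<chi>)
      \<in> extensional (carrier (free_group X))"
    by (rule compose_extensional)
  fix x assume x: "x \<in> X"
  then have "free_gen X x \<in> carrier (free_group X)" by (simp add: pres_gen_def pres_class_closed)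
  then show "compose (carrier (free_group X)) (subst_hom X \<phi>) (subst_hom X \<chi>) (free_gen X x)
      = pres_rel X {} `` {free_reduce (word_subst \<phi> (\<chi> x))}"
    using word_subst_words[OF \<phi> \<chi>w[OF x]]
    by (simp only: compose_eq subst_hom_gen[OF \<chi> x] subst_hom_class[OF \<phi> \<chi>w[OF x]]
        pres_class_free_reduce)
qed

lemma subst_hom_cong:
  assumes "\<And>x. x \<in> X \<Longrightarrow> \<phi> x = \<chi> x" "\<chi> \<in> X \<rightarrow> words X"
  shows "subst_hom X \<phi> = subst_hom X \<chi>"
proof (rule hom_eq_subst_hom[OF assms(2)])
  have \<phi>: "\<phi> \<in> X \<rightarrow> words X" using assms by (auto simp: Pi_iff)
  show "subst_hom X \<phi> \<in> hom (free_group X) (free_group X)" by (rule subst_hom_hom[OF \<phi>])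
  show "subst_hom X \<phi> \<in> extensional (carrier (free_group X))" by (simp add: subst_hom_def)
  show "subst_hom X \<phi> (free_gen X x) = pres_rel X {} `` {\<chi> x}" if "x \<in> X" for x
    using assms(1) that by (simp add: subst_hom_gen[OF \<phi>])
qed

lemma subst_hom_id: "subst_hom X (\<lambda>x. [(x, True)]) = (\<lambda>A\<in>carrier (free_group X). A)"
proof -
  interpret F: group "free_group X" by (rule group_pres_group)
  show ?thesis
    by (rule hom_eq_subst_hom[symmetric])
      (simp_all add: hom_def pres_gen_def pres_class_closed)
qed

text \<open>Both composites of the two substitutions are the identity, since they fix every
  generator; hence each map is the inverse of the other on the carrier.\<close>

lemma subst_hom_inverse_auto:
  assumes \<phi>: "\<phi> \<in> X \<rightarrow> words X" and \<chi>: "\<chi> \<in> X \<rightarrow> words X"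
    and inv: "\<And>x. x \<in> X \<Longrightarrow> free_reduce (word_subst \<phi> (\<chi> x)) = [(x, True)]"
      "\<And>x. x \<in> X \<Longrightarrow> free_reduce (word_subst \<chi> (\<phi> x)) = [(x, True)]"
  shows "subst_hom X \<phi> \<in> auto (free_group X)"
proof -
  let ?C = "carrier (free_group X)"
  have id: "(\<lambda>x. [(x, True)]) \<in> X \<rightarrow> words X" by auto
  have 1: "compose ?C (subst_hom X \<phi>) (subst_hom X \<chi>) = (\<lambda>A\<in>?C. A)"
    unfolding compose_subst_hom[OF \<phi> \<chi>] subst_hom_id[symmetric]
    by (rule subst_hom_cong[OF inv(1) id])
  have 2: "compose ?C (subst_hom X \<chi>) (subst_hom X \<phi>) = (\<lambda>A\<in>?C. A)"
    unfolding compose_subst_hom[OF \<chi> \<phi>] subst_hom_id[symmetric]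
    by (rule subst_hom_cong[OF inv(2) id])
  have "bij_betw (subst_hom X \<phi>) ?C ?C"
  proof (rule bij_betw_byWitness[where f' = "subst_hom X \<chi>"])
    show "\<forall>A\<in>?C. subst_hom X \<chi> (subst_hom X \<phi> A) = A"
    proof
      fix A assume "A \<in> ?C"
      then show "subst_hom X \<chi> (subst_hom X \<phi> A) = A"
        using fun_cong[OF 2, of A] by (simp only: compose_eq restrict_apply')
    qed
    show "\<forall>A\<in>?C. subst_hom X \<phi> (subst_hom X \<chi> A) = A"
    proof
      fix A assume "A \<in> ?C"
      then show "subst_hom X \<phi> (subst_hom X \<chi> A) = A"
        using fun_cong[OF 1, of A] by (simp only: compose_eq restrict_apply')
    qed
    show "subst_hom X \<phi> ` ?C \<subseteq> ?C" "subst_hom X \<chi> ` ?C \<subseteq> ?C"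
      using subst_hom_hom[OF \<phi>] subst_hom_hom[OF \<chi>] by (auto simp: hom_def)
  qed
  then show ?thesis
    using subst_hom_hom[OF \<phi>] by (simp add: auto_def Bij_def subst_hom_def)
qed

section \<open>The automorphism group as composition of maps\<close>

lemma mult_AutoGroup:
  "g \<in> auto G \<Longrightarrow> f \<in> auto G \<Longrightarrow> g \<otimes>\<^bsub>AutoGroup G\<^esub> f = compose (carrier G) g f"
  by (simp add: AutoGroup_def BijGroup_def auto_def)

lemma one_AutoGroup: "\<one>\<^bsub>AutoGroup G\<^esub> = (\<lambda>x\<in>carrier G. x)"
  and carrier_AutoGroup: "carrier (AutoGroup G) = auto G"
  by (simp_all add: AutoGroup_def BijGroup_def)

section \<open>The representation of the virtual braid group\<close>

text \<open>The clause for a negative \<open>Sigma_gen i\<close> gives the inverse automorphism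
  explicitly. The clause for \<open>Tau_gen i\<close> ignores the sign because this automorphism is
  an involution.\<close>

fun psi_letter :: "vb_generator \<times> bool \<Rightarrow> f5_generator \<Rightarrow> f5_generator word"
  where
    "psi_letter l Q_gen = [(Q_gen, True)]"
  | "psi_letter (Sigma_gen i, True) (X_gen j) =
      (if j = i then [(X_gen i, True), (X_gen (i + 1), True), (X_gen i, False)]
       else if j = i + 1 then [(X_gen i, True)] else [(X_gen j, True)])"
  | "psi_letter (Sigma_gen i, False) (X_gen j) =
      (if j = i then [(X_gen (i + 1), True)]
       else if j = i + 1 then [(X_gen (i + 1), False), (X_gen i, True), (X_gen (i + 1), True)]
       else [(X_gen j, True)])"
  | "psi_letter (Tau_gen i, b) (X_gen j) =
      (if j = i then [(Q_gen, True), (X_gen (i + 1), True), (Q_gen, False)]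
       else if j = i + 1 then [(Q_gen, False), (X_gen i, True), (Q_gen, True)]
       else [(X_gen j, True)])"

text \<open>The first letter of the braid word is applied last, as in \<open>\<psi>(\<alpha>\<beta>) = \<psi>(\<alpha>) \<circ> \<psi>(\<beta>)\<close>.\<close>

primrec psi_word :: "vb_generator word \<Rightarrow> f5_generator \<Rightarrow> f5_generator word"
  where
    "psi_word [] x = [(x, True)]"
  | "psi_word (l # w) x = free_reduce (word_subst (psi_letter l) (psi_word w x))"

definition psi_gen :: "vb_generator \<Rightarrow> f5_generator word set \<Rightarrow> f5_generator word set"
  where "psi_gen g = subst_hom f5_generators (psi_letter (g, True))"

lemma vb_generators_4:
  "vb_generators 4 = {Sigma_gen 1, Sigma_gen 2, Sigma_gen 3, Tau_gen 1, Tau_gen 2, Tau_gen 3}"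
proof -
  have "{i::nat. 1 \<le> i \<and> i < 4} = {1, 2, 3}" by auto
  then show ?thesis by (simp add: vb_generators_def insert_commute)
qed

lemma psi_letter_words:
  "g \<in> vb_generators 4 \<Longrightarrow> psi_letter (g, b) \<in> f5_generators \<rightarrow> words f5_generators"
  unfolding vb_generators_4 by (cases b) (auto simp: f5_generators_def)

lemma psi_word_words:
  assumes "w \<in> words (vb_generators 4)"
  shows "psi_word w \<in> f5_generators \<rightarrow> words f5_generators"
  using assms
proof (induction w)
  case (Cons l w)
  then have "fst l \<in> vb_generators 4" by auto
  then have "psi_letter l \<in> f5_generators \<rightarrow> words f5_generators"
    using psi_letter_words[of "fst l" "snd l"] by simp
  moreover have "psi_word w x \<in> words f5_generators" if "x \<in> f5_generators" for x
    using Cons.IH that by blast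
  ultimately show ?case
    by (intro funcsetI) (simp add: free_reduce_words word_subst_words)
qed auto

text \<open>A finite computation over generators and signs. Since \<open>b\<close> is arbitrary,
  both orders of composition are covered.\<close>

lemma psi_letter_inverse:
  assumes "g \<in> vb_generators 4" "x \<in> f5_generators"
  shows "free_reduce (word_subst (psi_letter (g, b)) (psi_letter (g, \<not> b) x)) = [(x, True)]"
  using assms unfolding vb_generators_4 f5_generators_def
  by (cases b) (auto simp: word_subst_def free_reduce_def)

lemma subst_hom_psi_letter_auto:
  "g \<in> vb_generators 4 \<Longrightarrow> subst_hom f5_generators (psi_letter (g, b)) \<in> auto F5"
  unfolding F5_def
  using psi_letter_inverse[of g _ b] psi_letter_inverse[of g _ "\<not> b"]
  by (intro subst_hom_inverse_auto[where \<chi> = "psi_letter (g, \<not> b)"] psi_letter_words) auto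

lemma group_F5: "group F5"
  unfolding F5_def by (rule group_pres_group)

lemma group_AutoGroup_F5: "group (AutoGroup F5)"
  by (rule group.AutoGroup[OF group_F5])

lemma psi_gen_closed: "psi_gen \<in> vb_generators 4 \<rightarrow> carrier (AutoGroup F5)"
  by (simp add: psi_gen_def carrier_AutoGroup subst_hom_psi_letter_auto)

lemma letter_value_psi_gen:
  assumes "g \<in> vb_generators 4"
  shows "letter_value (AutoGroup F5) psi_gen (g, b) = subst_hom f5_generators (psi_letter (g, b))"
proof (cases b)
  case True
  then show ?thesis by (simp add: letter_value_def psi_gen_def)
next
  case False
  have id: "(\<lambda>x. [(x, True)]) \<in> f5_generators \<rightarrow> words f5_generators" by auto
  \<comment> \<open>The explicit substitution for the negative letter is a left inverse of
    \<open>psi_gen g\<close>, hence its inverse in \<open>AutoGroup F5\<close>.\<close>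
  have "compose (carrier F5) (subst_hom f5_generators (psi_letter (g, False))) (psi_gen g)
      = subst_hom f5_generators (\<lambda>x. [(x, True)])"
    unfolding F5_def psi_gen_def
      compose_subst_hom[OF psi_letter_words[OF assms] psi_letter_words[OF assms]]
    using psi_letter_inverse[OF assms, of _ False] by (intro subst_hom_cong id) simp
  then have "subst_hom f5_generators (psi_letter (g, False)) \<otimes>\<^bsub>AutoGroup F5\<^esub> psi_gen g
      = \<one>\<^bsub>AutoGroup F5\<^esub>"
    using subst_hom_psi_letter_auto[OF assms]
    by (simp add: mult_AutoGroup psi_gen_def one_AutoGroup subst_hom_id F5_def)
  then show ?thesis
    using assms False subst_hom_psi_letter_auto[OF assms] group.inv_equality[OF group_AutoGroup_F5]
    by (simp add: letter_value_def carrier_AutoGroup psi_gen_def)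
qed

text \<open>This turns products of automorphisms into the computable words of
  \<open>psi_word\<close>: each further letter composes one substitution on the outside.\<close>

lemma word_value_psi_gen:
  assumes "w \<in> words (vb_generators 4)"
  shows "word_value (AutoGroup F5) psi_gen w = subst_hom f5_generators (psi_word w)"
  using assms
proof (induction w)
  case Nil
  then show ?case
    using subst_hom_id[of f5_generators] by (simp add: one_AutoGroup F5_def)
next
  case (Cons l w)
  obtain g b where l: "l = (g, b)" by (cases l)
  have g: "g \<in> vb_generators 4" and w: "w \<in> words (vb_generators 4)" using Cons l by auto
  \<comment> \<open>Closure of evaluation gives this without exhibiting an inverse of
    \<open>psi_word w\<close>; it allows the product to be read as a composition.\<close>
  have "subst_hom f5_generators (psi_word w) \<in> auto F5"
    using group.word_value_closed[OF group_AutoGroup_F5 psi_gen_closed w] Cons.IH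
    by (simp add: carrier_AutoGroup)
  then have "word_value (AutoGroup F5) psi_gen (l # w) = compose (carrier F5)
      (subst_hom f5_generators (psi_letter l)) (subst_hom f5_generators (psi_word w))"
    using subst_hom_psi_letter_auto[OF g, of b]
    by (simp add: l letter_value_psi_gen[OF g] Cons.IH mult_AutoGroup)
  also have "\<dots> = subst_hom f5_generators (psi_word (l # w))"
    unfolding F5_def l compose_subst_hom[OF psi_letter_words[OF g] psi_word_words[OF w]]
    by (rule arg_cong[where f = "subst_hom f5_generators"]) auto
  finally show ?case .
qed

text \<open>With four strands each family has only finitely many instances, and on each generator of
  \<open>F5\<close> the two sides reduce to the same word.\<close>

lemma psi_word_relation:
  assumes "(r, s) \<in> vb_relations 4" "x \<in> f5_generators"
  shows "psi_word r x = psi_word s x"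
proof -
  have range: "i = 1 \<or> i = 2 \<or> i = 3" if "1 \<le> i" "i < 4" for i :: nat using that by auto
  have range': "i = 1 \<or> i = 2" if "1 \<le> i" "i + 1 < 4" for i :: nat using that by auto
  \<comment> \<open>Among the indices 1, 2, 3 only 1 and 3 differ by more than one.\<close>
  have far: "i = 1 \<and> j = 3 \<or> i = 3 \<and> j = 1"
    if "1 \<le> i" "i < 4" "1 \<le> j" "j < 4" "\<bar>int i - int j\<bar> > 1" for i j :: nat
    using range[of i] range[of j] that by auto
  have x: "x = X_gen 1 \<or> x = X_gen 2 \<or> x = X_gen 3 \<or> x = X_gen 4 \<or> x = Q_gen"
    using assms(2) by (simp add: f5_generators_def)
  from assms(1) show ?thesis
  proof cases
    case (sigma_far i j)
    from far[OF sigma_far(3-7)] x show ?thesis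
      unfolding sigma_far(1,2) by (elim disjE conjE) (simp_all add: word_subst_def free_reduce_def)
  next
    case (tau_far i j)
    from far[OF tau_far(3-7)] x show ?thesis
      unfolding tau_far(1,2) by (elim disjE conjE) (simp_all add: word_subst_def free_reduce_def)
  next
    case (sigma_tau_far i j)
    from far[OF sigma_tau_far(3-7)] x show ?thesis
      unfolding sigma_tau_far(1,2) by (elim disjE conjE) (simp_all add: word_subst_def free_reduce_def)
  next
    case (sigma_braid i)
    from range'[OF sigma_braid(3-4)] x show ?thesis
      unfolding sigma_braid(1,2) by (elim disjE conjE) (simp_all add: word_subst_def free_reduce_def)
  next
    case (tau_braid i)
    from range'[OF tau_braid(3-4)] x show ?thesis
      unfolding tau_braid(1,2) by (elim disjE conjE) (simp_all add: word_subst_def free_reduce_def)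
  next
    case (mixed i)
    from range'[OF mixed(3-4)] x show ?thesis
      unfolding mixed(1,2) by (elim disjE conjE) (simp_all add: word_subst_def free_reduce_def)
  next
    case (tau_square i)
    from range[OF tau_square(3-4)] x show ?thesis
      unfolding tau_square(1,2) by (elim disjE conjE) (simp_all add: word_subst_def free_reduce_def)
  qed
qed

lemma vb_relations_words: "(r, s) \<in> vb_relations n \<Longrightarrow> {r, s} \<subseteq> words (vb_generators n)"
  by (induction rule: vb_relations.induct) (auto simp: vb_generators_def)

lemma word_value_psi_gen_relation:
  assumes "(r, s) \<in> vb_relations 4"
  shows "word_value (AutoGroup F5) psi_gen r = word_value (AutoGroup F5) psi_gen s"
proof -
  have "r \<in> words (vb_generators 4)" "s \<in> words (vb_generators 4)"
    using vb_relations_words[OF assms] by blast+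
  then show ?thesis
    using subst_hom_cong[OF psi_word_relation[OF assms] psi_word_words]
    by (simp add: word_value_psi_gen)
qed

section \<open>The braid beta and its action\<close>

definition beta_word :: "vb_generator word"
  where "beta_word = concat (replicate 3
    [t_letter 3, s_letter 2, t_letter 1, (Sigma_gen 2, False)])"

text \<open>One block of \<open>beta_word\<close> fixes q and x2, and sends x1 to (q x2 q) x4 (q x2
  q)^-1, x4 to q^-1 x3 q, and x3 to (q x2)^-1 x1 (q x2). The conjugators involve only the fixed q
  and x2, and their product around the 3-cycle is trivial, so the third power is the
  identity.\<close>

lemma psi_word_beta:
  assumes "x \<in> f5_generators"
  shows "psi_word beta_word x = [(x, True)]"
proof -
  have "list_all (\<lambda>x. psi_word beta_word x = [(x, True)])
      [X_gen 1, X_gen 2, X_gen 3, X_gen 4, Q_gen]"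
    by code_simp
  with assms show ?thesis
    by (auto simp: f5_generators_def)
qed

lemma beta_word_words: "beta_word \<in> words (vb_generators 4)"
  by (simp add: beta_word_def vb_generators_4 numeral_3_eq_3)

lemma vb_beta_eq: "vb_beta = pres_rel (vb_generators 4) (vb_relations 4) `` {beta_word}"
proof -
  let ?G = "virtual_braid_group 4"
  let ?c = "\<lambda>w. pres_rel (vb_generators 4) (vb_relations 4) `` {w}"
  let ?w = "[t_letter 3, s_letter 2, t_letter 1, (Sigma_gen 2, False)]"
  have gens: "Tau_gen 3 \<in> vb_generators 4" "Sigma_gen 2 \<in> vb_generators 4"
      "Tau_gen 1 \<in> vb_generators 4"
    by (simp_all add: vb_generators_def)
  have mult: "?c u \<otimes>\<^bsub>?G\<^esub> ?c v = ?c (u @ v)"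
    if "u \<in> words (vb_generators 4)" "v \<in> words (vb_generators 4)" for u v
    using that by (simp add: virtual_braid_group_def pres_group_mult_class)
  have inv: "inv\<^bsub>?G\<^esub> ?c [s_letter 2] = ?c [(Sigma_gen 2, False)]"
    using gens by (simp add: virtual_braid_group_def inv_pres_class)
  have one: "\<one>\<^bsub>?G\<^esub> = ?c []" by (simp add: virtual_braid_group_def one_pres_group)
  have "vb_beta = ?c ?w [^]\<^bsub>?G\<^esub> (3::nat)"
    unfolding vb_beta_def vb_tau_def vb_sigma_def pres_gen_def inv
    using gens by (simp add: mult)
  \<comment> \<open>The power unfolds by right multiplication, starting from the class of the empty
    word.\<close>
  also have "\<dots> = ?c (?w @ ?w @ ?w)"
    unfolding numeral_3_eq_3 nat_pow_Suc nat_pow_0 one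
    using gens by (simp add: mult numeral_3_eq_3)
  also have "?w @ ?w @ ?w = beta_word" by (simp add: beta_word_def numeral_3_eq_3)
  finally show ?thesis .
qed

section \<open>Reading the definition of psi on generators\<close>

lemma auto_F5_eq_psi_gen_iff:
  assumes "h \<in> auto F5" "g \<in> vb_generators 4"
  shows "h = psi_gen g \<longleftrightarrow> (\<forall>x\<in>f5_generators.
    h (free_gen f5_generators x) = pres_rel f5_generators {} `` {psi_letter (g, True) x})"
proof
  assume "h = psi_gen g"
  then show "\<forall>x\<in>f5_generators.
      h (free_gen f5_generators x) = pres_rel f5_generators {} `` {psi_letter (g, True) x}"
    by (simp add: psi_gen_def subst_hom_gen[OF psi_letter_words[OF assms(2)]])
next
  assume "\<forall>x\<in>f5_generators.
      h (free_gen f5_generators x) = pres_rel f5_generators {} `` {psi_letter (g, True) x}"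
  then show "h = psi_gen g"
    unfolding psi_gen_def using assms(1)
    by (intro hom_eq_subst_hom[OF psi_letter_words[OF assms(2)]])
      (auto simp: auto_def Bij_def F5_def)
qed

text \<open>The pointwise formulas of \<open>is_psi\<close> become equalities in
  \<open>AutoGroup F5\<close>, because an automorphism of \<open>F5\<close> is determined by its
  values on the five generators.\<close>

lemma is_psi_iff_gen:
  assumes "\<psi> \<in> hom (virtual_braid_group 4) (AutoGroup F5)"
  shows "is_psi \<psi> \<longleftrightarrow> (\<forall>g\<in>vb_generators 4.
    \<psi> (pres_gen (vb_generators 4) (vb_relations 4) g) = psi_gen g)"
proof -
  have auto: "\<psi> (pres_gen (vb_generators 4) (vb_relations 4) g) \<in> auto F5"
    if "g \<in> vb_generators 4" for g
    using assms that
    by (auto simp: hom_def carrier_AutoGroup virtual_braid_group_def pres_gen_def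
        intro!: pres_class_closed)
  have iff: "(\<forall>g\<in>vb_generators 4. \<psi> (pres_gen (vb_generators 4) (vb_relations 4) g) = psi_gen g)
      \<longleftrightarrow> (\<forall>g\<in>vb_generators 4. \<forall>x\<in>f5_generators.
        \<psi> (pres_gen (vb_generators 4) (vb_relations 4) g) (free_gen f5_generators x)
          = pres_rel f5_generators {} `` {psi_letter (g, True) x})"
    using auto_F5_eq_psi_gen_iff[OF auto] by blast
  have vb: "(\<forall>g\<in>vb_generators 4. P g) \<longleftrightarrow> (\<forall>i\<in>{1..3}. P (Sigma_gen i) \<and> P (Tau_gen i))" for P
    by (auto simp: vb_generators_def)
  have four: "{1..4} = {1, 2, 3, 4::nat}" by auto
  have f5: "(\<forall>x\<in>f5_generators. P x) \<longleftrightarrow> P Q_gen \<and> (\<forall>j\<in>{1..4}. P (X_gen j))" for P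
    unfolding f5_generators_def four by blast
  have X: "X_gen j \<in> f5_generators" if "j \<in> {1..4}" for j
    using that unfolding four f5_generators_def by blast
  have Q: "Q_gen \<in> f5_generators" by (simp add: f5_generators_def)
  \<comment> \<open>The bound on \<open>i\<close> keeps both \<open>X_gen i\<close> and
    \<open>X_gen (i + 1)\<close> among the generators, so the products are classes of explicit
    words.\<close>
  have conj:
      "f5_x i \<otimes>\<^bsub>F5\<^esub> f5_x (i + 1) \<otimes>\<^bsub>F5\<^esub> inv\<^bsub>F5\<^esub> f5_x i = pres_rel f5_generators {} ``
        {[(X_gen i, True), (X_gen (i + 1), True), (X_gen i, False)]}"
      "f5_q \<otimes>\<^bsub>F5\<^esub> f5_x (i + 1) \<otimes>\<^bsub>F5\<^esub> inv\<^bsub>F5\<^esub> f5_q = pres_rel f5_generators {} ``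
        {[(Q_gen, True), (X_gen (i + 1), True), (Q_gen, False)]}"
      "inv\<^bsub>F5\<^esub> f5_q \<otimes>\<^bsub>F5\<^esub> f5_x i \<otimes>\<^bsub>F5\<^esub> f5_q = pres_rel f5_generators {} ``
        {[(Q_gen, False), (X_gen i, True), (Q_gen, True)]}"
    if "i \<in> {1..3}" for i
    using X[of i] X[of "i + 1"] Q that
    by (simp_all add: f5_x_def f5_q_def F5_def pres_gen_def inv_pres_class pres_group_mult_class)
  have sigma: "(if j = i then f5_x i \<otimes>\<^bsub>F5\<^esub> f5_x (i + 1) \<otimes>\<^bsub>F5\<^esub> inv\<^bsub>F5\<^esub> f5_x i
      else if j = i + 1 then f5_x i else f5_x j)
      = pres_rel f5_generators {} `` {psi_letter (Sigma_gen i, True) (X_gen j)}"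
    if "i \<in> {1..3}" for i j
    unfolding conj[OF that] by (simp add: f5_x_def pres_gen_def)
  have tau: "(if j = i then f5_q \<otimes>\<^bsub>F5\<^esub> f5_x (i + 1) \<otimes>\<^bsub>F5\<^esub> inv\<^bsub>F5\<^esub> f5_q
      else if j = i + 1 then inv\<^bsub>F5\<^esub> f5_q \<otimes>\<^bsub>F5\<^esub> f5_x i \<otimes>\<^bsub>F5\<^esub> f5_q else f5_x j)
      = pres_rel f5_generators {} `` {psi_letter (Tau_gen i, True) (X_gen j)}"
    if "i \<in> {1..3}" for i j
    unfolding conj[OF that] by (simp add: f5_x_def pres_gen_def)
  have q: "f5_q = pres_rel f5_generators {} `` {psi_letter l Q_gen}" for l
    by (simp add: f5_q_def pres_gen_def)
  have "is_psi \<psi> \<longleftrightarrow> (\<forall>i\<in>{1..3}.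
      \<psi> (vb_sigma 4 i) f5_q = pres_rel f5_generators {} `` {psi_letter (Sigma_gen i, True) Q_gen} \<and>
      \<psi> (vb_tau 4 i) f5_q = pres_rel f5_generators {} `` {psi_letter (Tau_gen i, True) Q_gen} \<and>
      (\<forall>j\<in>{1..4}.
        \<psi> (vb_sigma 4 i) (f5_x j)
          = pres_rel f5_generators {} `` {psi_letter (Sigma_gen i, True) (X_gen j)} \<and>
        \<psi> (vb_tau 4 i) (f5_x j)
          = pres_rel f5_generators {} `` {psi_letter (Tau_gen i, True) (X_gen j)}))"
    unfolding is_psi_def q[symmetric] using assms by (simp only: sigma tau simp_thms cong: ball_cong)
  then show ?thesis
    unfolding iff vb f5 vb_sigma_def[symmetric] vb_tau_def[symmetric]
      f5_x_def[symmetric] f5_q_def[symmetric]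
    by blast
qed

theorem mainTheorem2:
  shows "(\<exists>\<psi>. is_psi \<psi>) \<and>
    (\<forall>\<psi>. is_psi \<psi> \<longrightarrow> vb_beta \<in> kernel (virtual_braid_group 4) (AutoGroup F5) \<psi>)"
proof (intro conjI allI impI)
  interpret A: group "AutoGroup F5" by (rule group_AutoGroup_F5)
  \<comment> \<open>The witness comes from the universal property, applicable because
    \<open>psi_gen\<close> satisfies the braid relations.\<close>
  let ?\<psi> = "pres_lift (AutoGroup F5) psi_gen"
  have hom: "?\<psi> \<in> hom (virtual_braid_group 4) (AutoGroup F5)"
    unfolding virtual_braid_group_def
    by (rule A.pres_lift_hom[OF psi_gen_closed word_value_psi_gen_relation])
  have "is_psi ?\<psi>"
    unfolding is_psi_iff_gen[OF hom]
    using A.pres_lift_gen[OF psi_gen_closed word_value_psi_gen_relation] by blast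
  then show "\<exists>\<psi>. is_psi \<psi>" by blast
next
  interpret A: group "AutoGroup F5" by (rule group_AutoGroup_F5)
  fix \<psi> assume psi: "is_psi \<psi>"
  then have hom: "\<psi> \<in> hom (virtual_braid_group 4) (AutoGroup F5)" by (simp add: is_psi_def)
  have "\<psi> vb_beta = word_value (AutoGroup F5)
      (\<lambda>g. \<psi> (pres_gen (vb_generators 4) (vb_relations 4) g)) beta_word"
    unfolding vb_beta_eq
    using A.hom_pres_class[OF hom[unfolded virtual_braid_group_def] beta_word_words] .
  \<comment> \<open>Evaluation sees an arbitrary \<open>\<psi>\<close> only through its values on
    generators, which \<open>is_psi\<close> fixes.\<close>
  also have "\<dots> = word_value (AutoGroup F5) psi_gen beta_word"
    using psi[unfolded is_psi_iff_gen[OF hom]]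
    by (intro A.word_value_cong[OF _ beta_word_words]) blast
  also have "\<dots> = subst_hom f5_generators (\<lambda>x. [(x, True)])"
    unfolding word_value_psi_gen[OF beta_word_words]
    by (rule subst_hom_cong) (auto simp: psi_word_beta)
  also have "\<dots> = \<one>\<^bsub>AutoGroup F5\<^esub>"
    by (simp add: subst_hom_id one_AutoGroup F5_def)
  \<comment> \<open>Membership in the kernel also requires \<open>vb_beta\<close> to lie in the
    carrier, which holds because it is the class of \<open>beta_word\<close>.\<close>
  finally show "vb_beta \<in> kernel (virtual_braid_group 4) (AutoGroup F5) \<psi>"
    using pres_class_closed[OF beta_word_words, of "vb_relations 4"]
    by (simp add: kernel_def vb_beta_eq virtual_braid_group_def)
qed

end
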